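(* Let $M$ be a matroid on $[n]$ of rank $r$. Then the cocircuit polytope $O_M\subset\mathbb{R}^n$ (a) is given by the equation $\sum_{i=1}^n x_i = D([n])$ and the inequalities $\sum_{i \in S} x_i \leq D(S)$ for $S \subseteq [n]$, where $D(S)$ is the number of cocircuits of $M$ intersecting $S$; (b) has dimension $n-c$, where $c$ is the number of connected components of $M$; (c) has the matroid polytope $P_M = \mathrm{conv}\{e_B : B \text{ basis of } M\}$ as a Minkowski summand; (d) has at most $r! \cdot b$ vertices, where $b$ is the number of bases of $M$.
   Context: Let $e_1,\dots,e_n$ be the standard basis of $\mathbb{R}^n$. For $S\subseteq[n]$ let $e_S=\sum_{s\in S}e_s$ and $\Delta_S=\mathrm{conv}\{e_s: s\in S\}$. The Minkowski sum of $P,Q\subset\mathbb{R}^n$ is $P+Q=\{p+q:p\in P,q\in Q\}$; a polytope $P$ is a Minkowski summand of $O$ if $O=P+Q$ for some polytope $Q$. A cocircuit of $M$ is a circuit of the dual matroid $M^*$. The cocircuit polytope of $M$ is $$O_M=\sum_{D\text{ cocircuit of }M}\Delta_D.$$ The connected components of $M$ are the equivalence classes of the equivalence relation on $[n]$ in which $a\sim b$ if $a=b$ or $a,b\in C$ for some circuit $C$ of $M$. *)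

theory Defs
  imports "HOL-Analysis.Analysis" "HOL-Library.Set_Algebras"
begin

locale matroid =
  fixes E :: "'a set"  \<comment> \<open>ground set\<close>
    and I :: "'a set set"  \<comment> \<open>independent sets\<close>
  assumes finite_ground: "finite E"
    and indep_subset_ground: "X \<in> I \<Longrightarrow> X \<subseteq> E"
    and empty_indep: "{} \<in> I"
    and indep_mono: "X \<in> I \<Longrightarrow> Y \<subseteq> X \<Longrightarrow> Y \<in> I"
    and augment: "X \<in> I \<Longrightarrow> Y \<in> I \<Longrightarrow> card X < card Y \<Longrightarrow> \<exists>y \<in> Y - X. insert y X \<in> I"

definition bases :: "'a set set \<Rightarrow> 'a set set" where
  "bases I = {B \<in> I. \<forall>X \<in> I. B \<subseteq> X \<longrightarrow> X = B}"

definition matroid_rank :: "'a set set \<Rightarrow> nat" where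
  "matroid_rank I = Max (card ` I)"

definition circuits :: "'a set \<Rightarrow> 'a set set \<Rightarrow> 'a set set" where
  "circuits E I = {C. C \<subseteq> E \<and> C \<notin> I \<and> (\<forall>X. X \<subset> C \<longrightarrow> X \<in> I)}"

text \<open>The dual matroid is the one whose bases are the complements of the bases, so its
  independent sets are the subsets of such complements.\<close>

definition dual_indep :: "'a set \<Rightarrow> 'a set set \<Rightarrow> 'a set set" where
  "dual_indep E I = {X. \<exists>B \<in> bases I. X \<subseteq> E - B}"

definition cocircuits :: "'a set \<Rightarrow> 'a set set \<Rightarrow> 'a set set" where
  "cocircuits E I = circuits E (dual_indep E I)"

definition matroid_conn :: "'a set \<Rightarrow> 'a set set \<Rightarrow> ('a \<times> 'a) set" where
  "matroid_conn E I = {(a, b) \<in> E \<times> E. a = b \<or> (\<exists>C \<in> circuits E I. a \<in> C \<and> b \<in> C)}"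

definition matroid_components :: "'a set \<Rightarrow> 'a set set \<Rightarrow> 'a set set" where
  "matroid_components E I = E // matroid_conn E I"

definition e_vec :: "'n set \<Rightarrow> real ^ 'n::finite" where
  "e_vec S = (\<Sum>s\<in>S. axis s 1)"

definition simplex_on :: "'n set \<Rightarrow> (real ^ 'n::finite) set" where
  "simplex_on S = convex hull ((\<lambda>s. axis s 1) ` S)"

text \<open>Addition of sets is Minkowski addition, as defined in \<^theory>\<open>HOL-Library.Set_Algebras\<close>.
  The empty sum is \<open>{0}\<close>.\<close>

definition cocircuit_polytope :: "'n set set \<Rightarrow> (real ^ 'n::finite) set" where
  "cocircuit_polytope I = (\<Sum>D \<in> cocircuits UNIV I. simplex_on D)"

definition matroid_polytope :: "'n set set \<Rightarrow> (real ^ 'n::finite) set" where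
  "matroid_polytope I = convex hull (e_vec ` bases I)"

definition num_cocircuits_meeting :: "'a set \<Rightarrow> 'a set set \<Rightarrow> 'a set \<Rightarrow> nat" where
  "num_cocircuits_meeting E I S = card {D \<in> cocircuits E I. D \<inter> S \<noteq> {}}"

definition minkowski_summand :: "'v::euclidean_space set \<Rightarrow> 'v set \<Rightarrow> bool" where
  "minkowski_summand P R \<longleftrightarrow> polytope P \<and> (\<exists>Q. polytope Q \<and> R = P + Q)"

end

theory Submission
  imports Defs "HOL-Combinatorics.Multiset_Permutations"
begin

text \<open>For a set function \<open>f\<close> let \<open>base_polytope f\<close> consist of the points whose coordinates add up to
\<open>f UNIV\<close> and whose coordinate sum over each \<open>S\<close> is at most \<open>f S\<close>. Adding the ground set elements in
some order and recording the increments of \<open>f\<close> gives a vector, \<open>greedy_vec f\<close> of this order. By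
Abel summation a linear functional \<open>w\<close> is bounded on \<open>base_polytope f\<close> by its value at the greedy
vector of an order that adds the elements by decreasing weight. This holds for every \<open>f\<close> that
vanishes at the empty set, so \<open>base_polytope f\<close> always lies in the convex hull of the greedy vectors
(\<open>base_polytope_subset_hull\<close>). The description by inequalities and the Minkowski summand rest on this
inclusion.

The inequalities. Take \<open>f\<close> to be the number of cocircuits met. Its greedy vector is the sum, over
all cocircuits \<open>D\<close>, of the unit vector of the element of \<open>D\<close> added first, which is a point of the
Minkowski sum of the simplices. So the base polytope is contained in the Minkowski sum; the
converse inclusion is a direct estimate (\<open>sum_simplex_on_eq_base_polytope\<close>).

The Minkowski summand. The greedy vectors of the rank function are the indicator vectors of bases,
because greedily adding elements builds a basis. Greedy vectors are additive in \<open>f\<close>, so the greedy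
vectors of the cocircuit count are sums of those of the rank and those of \<open>g\<close>, the
difference of the two functions. Let \<open>Q\<close> be the hull of the greedy vectors of \<open>g\<close>. Then the cocircuit
polytope lies in the sum of the matroid polytope and \<open>Q\<close>, and equality holds as soon as \<open>Q\<close> satisfies
the inequalities given by \<open>g\<close>, which is the case for submodular \<open>g\<close>. Submodularity of \<open>g\<close> says that
whenever the marginal rank of an element \<open>i\<close> drops from one to zero between \<open>S\<close> and a larger set \<open>T\<close>,
some cocircuit contains \<open>i\<close>, avoids \<open>S\<close> and meets \<open>T\<close>; the fundamental cocircuit of \<open>i\<close> for a basis
that extends \<open>i\<close> and a maximal independent subset of \<open>S\<close> has these properties (\<open>separating_cocircuit\<close>).

The vertices. If \<open>B\<close> is a basis of maximum \<open>w\<close>-weight, then every cocircuit attains its maximal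
weight inside \<open>B\<close> (\<open>cocircuit_meets_max_weight_base\<close>). Hence \<open>w\<close> is maximized over the cocircuit
polytope by the greedy vector of an ordering of the elements of \<open>B\<close> alone, and the polytope is the
hull of the greedy vectors of ordered bases, of which there are \<open>r!\<close> for each basis.

The dimension. The directions of the affine hull of a sum of simplices are spanned by the
differences of unit vectors \<open>e\<^sub>a - e\<^sub>b\<close> with \<open>a\<close> and \<open>b\<close> in a common summand. Two distinct elements
share a cocircuit if and only if they share a circuit, since either means that one of them can
replace the other in some basis (\<open>common_circuit_iff_common_cocircuit\<close>). Sharing a circuit is an
equivalence relation by strong circuit elimination, and the orthogonal complement of the
differences consists of the vectors that are constant on its classes, a space whose dimension is the number of classes.\<close>

section \<open>Rank and bases\<close>

context matroid
begin

definition rk :: "'a set \<Rightarrow> nat" where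
  "rk S = Max (card ` {X \<in> I. X \<subseteq> S})"

lemma finite_indep: "X \<in> I \<Longrightarrow> finite X"
  using finite_ground indep_subset_ground finite_subset by blast

lemma finite_indeps: "finite I"
  by (rule finite_subset[of _ "Pow E"]) (use indep_subset_ground finite_ground in auto)

lemma card_le_rk: "X \<in> I \<Longrightarrow> X \<subseteq> S \<Longrightarrow> card X \<le> rk S"
  unfolding rk_def by (rule Max_ge) (use finite_indeps in auto)

lemma rk_attained: "\<exists>X \<in> I. X \<subseteq> S \<and> card X = rk S"
proof -
  have "rk S \<in> card ` {X \<in> I. X \<subseteq> S}"
    unfolding rk_def by (rule Max_in) (use finite_indeps empty_indep in auto)
  then show ?thesis by auto
qed

text \<open>An independent subset of \<open>S\<close> of largest size among those containing \<open>X\<close> has size \<open>rk S\<close>,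
  since otherwise it could be augmented from an independent set that attains \<open>rk S\<close>.\<close>
lemma extend_indep:
  assumes "X \<in> I" "X \<subseteq> S"
  shows "\<exists>Y \<in> I. X \<subseteq> Y \<and> Y \<subseteq> S \<and> card Y = rk S"
proof -
  let ?F = "{Y \<in> I. X \<subseteq> Y \<and> Y \<subseteq> S}"
  have fin: "finite (card ` ?F)" using finite_indeps by auto
  have ne: "card ` ?F \<noteq> {}" using assms by auto
  from Max_in[OF fin ne] obtain Y where Y: "Y \<in> ?F" "card Y = Max (card ` ?F)" by auto
  obtain Z where Z: "Z \<in> I" "Z \<subseteq> S" "card Z = rk S" using rk_attained by blast
  have "\<not> card Y < card Z"
  proof
    assume "card Y < card Z"
    then obtain z where z: "z \<in> Z - Y" "insert z Y \<in> I" using augment Y Z by blast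
    have "insert z Y \<in> ?F" using z Y Z by auto
    then have "card (insert z Y) \<le> card Y"
      using Y(2) Max_ge[OF fin] by (metis (no_types, lifting) imageI)
    moreover have "finite Y" using Y finite_indep by auto
    ultimately show False using z by simp
  qed
  moreover have "card Y \<le> rk S" using Y by (intro card_le_rk) auto
  ultimately show ?thesis using Y Z by (intro bexI[of _ Y]) auto
qed

lemma rk_mono: "S \<subseteq> T \<Longrightarrow> rk S \<le> rk T"
  using rk_attained[of S] card_le_rk[of _ T] by fastforce

lemma rk_indep:
  assumes "X \<in> I"
  shows "rk X = card X"
proof (rule antisym)
  obtain Y where "Y \<subseteq> X" "card Y = rk X" using rk_attained by blast
  then show "rk X \<le> card X" using finite_indep[OF assms] card_mono by metis
  show "card X \<le> rk X" using card_le_rk[OF assms] by simp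
qed

lemma rk_empty: "rk {} = 0"
  using rk_attained[of "{}"] by auto

text \<open>A maximal independent subset \<open>X\<close> of \<open>S\<close> decides alone whether a new element raises the rank: an
  independent set in \<open>insert x S\<close> larger than \<open>X\<close> augments \<open>X\<close>, and inside \<open>S\<close> there is no room left.\<close>
lemma rk_insert:
  assumes X: "X \<in> I" "X \<subseteq> S" "card X = rk S" and x: "x \<notin> S"
  shows "rk (insert x S) = (if insert x X \<in> I then Suc (rk S) else rk S)"
proof (cases "insert x X \<in> I")
  case True
  have fX: "finite X" using X finite_indep by auto
  have "x \<notin> X" using X x by auto
  then have ge: "Suc (rk S) \<le> rk (insert x S)"
    using card_le_rk[OF True, of "insert x S"] X fX by auto
  obtain Y where Y: "Y \<in> I" "Y \<subseteq> insert x S" "card Y = rk (insert x S)"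
    using rk_attained by blast
  have "card (Y - {x}) \<le> rk S" using Y by (intro card_le_rk) (auto intro: indep_mono)
  then have "card Y \<le> Suc (rk S)" using Y finite_indep by (simp add: card_Diff_singleton_if split: if_splits)
  then show ?thesis using ge Y True by auto
next
  case False
  have "rk (insert x S) \<le> rk S"
  proof (rule ccontr)
    assume gt: "\<not> ?thesis"
    obtain Y where Y: "Y \<in> I" "Y \<subseteq> insert x S" "card Y = rk (insert x S)"
      using rk_attained by blast
    with gt X have "card X < card Y" by auto
    then obtain y where y: "y \<in> Y - X" "insert y X \<in> I" using augment X Y by blast
    then have "y \<in> S" using Y False by auto
    then have "card (insert y X) \<le> rk S" using X y by (intro card_le_rk) auto
    then show False using y X finite_indep[of X] by auto
  qed
  then show ?thesis using False rk_mono[OF subset_insertI[of S x]] by simp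
qed

lemma bases_iff: "B \<in> bases I \<longleftrightarrow> B \<in> I \<and> card B = rk E"
proof
  assume B: "B \<in> bases I"
  then have BI: "B \<in> I" and max: "\<And>X. X \<in> I \<Longrightarrow> B \<subseteq> X \<Longrightarrow> X = B" by (auto simp: bases_def)
  obtain Y where "Y \<in> I" "B \<subseteq> Y" "card Y = rk E"
    using extend_indep[of B E] BI indep_subset_ground by blast
  then show "B \<in> I \<and> card B = rk E" using max BI by auto
next
  assume B: "B \<in> I \<and> card B = rk E"
  have "X = B" if X: "X \<in> I" "B \<subseteq> X" for X
  proof -
    have "card X \<le> card B" using B X card_le_rk indep_subset_ground by metis
    then show ?thesis using X finite_indep card_seteq by metis
  qed
  then show "B \<in> bases I" using B by (auto simp: bases_def)
qed

lemma base_indep: "B \<in> bases I \<Longrightarrow> B \<in> I"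
  by (simp add: bases_def)

lemma extend_to_base: "X \<in> I \<Longrightarrow> \<exists>B \<in> bases I. X \<subseteq> B"
  using extend_indep[of X E] indep_subset_ground by (auto simp: bases_iff)

lemma bases_nonempty: "bases I \<noteq> {}"
  using extend_to_base[OF empty_indep] by blast

lemma matroid_rank_eq: "matroid_rank I = rk E"
proof -
  have "{X \<in> I. X \<subseteq> E} = I" using indep_subset_ground by auto
  then show ?thesis by (simp add: matroid_rank_def rk_def)
qed

lemma exchange_is_base:
  assumes "B \<in> bases I" "b \<in> B" "x \<notin> B - {b}" "insert x (B - {b}) \<in> I"
  shows "insert x (B - {b}) \<in> bases I"
  using assms finite_indep[of B] card_Suc_Diff1[of B b] by (auto simp: bases_iff)

text \<open>A set is dependent in the dual matroid exactly if it meets every basis. Minimality then says that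
  each element of the set is the only one that some basis contains.\<close>
lemma cocircuits_iff:
  "D \<in> cocircuits E I \<longleftrightarrow>
     D \<subseteq> E \<and> (\<forall>B \<in> bases I. B \<inter> D \<noteq> {}) \<and> (\<forall>d \<in> D. \<exists>B \<in> bases I. B \<inter> D = {d})"
proof
  assume D: "D \<in> cocircuits E I"
  then have DE: "D \<subseteq> E" and nd: "D \<notin> dual_indep E I"
    and pr: "\<And>X. X \<subset> D \<Longrightarrow> X \<in> dual_indep E I"
    by (auto simp: cocircuits_def circuits_def)
  have meet: "B \<inter> D \<noteq> {}" if "B \<in> bases I" for B
    using nd DE that by (auto simp: dual_indep_def)
  have "\<exists>B \<in> bases I. B \<inter> D = {d}" if d: "d \<in> D" for d
  proof -
    have "D - {d} \<in> dual_indep E I" using pr d by auto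
    then obtain B where B: "B \<in> bases I" "D - {d} \<subseteq> E - B" by (auto simp: dual_indep_def)
    then have "B \<inter> D = {d}" using meet[of B] by auto
    then show ?thesis using B by auto
  qed
  then show "D \<subseteq> E \<and> (\<forall>B \<in> bases I. B \<inter> D \<noteq> {}) \<and> (\<forall>d \<in> D. \<exists>B \<in> bases I. B \<inter> D = {d})"
    using DE meet by auto
next
  assume D: "D \<subseteq> E \<and> (\<forall>B \<in> bases I. B \<inter> D \<noteq> {}) \<and> (\<forall>d \<in> D. \<exists>B \<in> bases I. B \<inter> D = {d})"
  have "X \<in> dual_indep E I" if X: "X \<subset> D" for X
  proof -
    obtain d where d: "d \<in> D" "d \<notin> X" using X by auto
    then obtain B where "B \<in> bases I" "B \<inter> D = {d}" using D by auto
    then show ?thesis using X d D by (auto simp: dual_indep_def intro!: bexI[of _ B])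
  qed
  moreover have "D \<notin> dual_indep E I" using D by (fastforce simp: dual_indep_def)
  ultimately show "D \<in> cocircuits E I" using D by (auto simp: cocircuits_def circuits_def)
qed

lemma cocircuit_subset_ground: "D \<in> cocircuits E I \<Longrightarrow> D \<subseteq> E"
  by (simp add: cocircuits_iff)

lemma cocircuit_meets_base: "D \<in> cocircuits E I \<Longrightarrow> B \<in> bases I \<Longrightarrow> B \<inter> D \<noteq> {}"
  by (simp add: cocircuits_iff)

lemma cocircuit_private_base: "D \<in> cocircuits E I \<Longrightarrow> d \<in> D \<Longrightarrow> \<exists>B \<in> bases I. B \<inter> D = {d}"
  by (simp add: cocircuits_iff)

text \<open>For a basis \<open>B\<close> and \<open>b \<in> B\<close>, the unique cocircuit in the complement of \<open>B - {b}\<close>.\<close>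
definition fundamental_cocircuit :: "'a set \<Rightarrow> 'a \<Rightarrow> 'a set" where
  "fundamental_cocircuit B b = {x. x \<notin> B - {b} \<and> insert x (B - {b}) \<in> I}"

lemma fundamental_cocircuit:
  assumes B: "B \<in> bases I" "b \<in> B"
  shows "fundamental_cocircuit B b \<in> cocircuits E I"
  unfolding cocircuits_iff
proof (intro conjI ballI)
  let ?D = "fundamental_cocircuit B b"
  have BI: "B \<in> I" using B by (auto simp: bases_iff)
  have fB: "finite B" using BI finite_indep by auto
  show "?D \<subseteq> E"
    unfolding fundamental_cocircuit_def using indep_subset_ground by blast
  show "B' \<inter> ?D \<noteq> {}" if "B' \<in> bases I" for B'
  proof -
    have "B - {b} \<in> I" using BI indep_mono by blast
    moreover have "card (B - {b}) < card B'"
      using that B fB card_Diff1_less[of B b] by (simp add: bases_iff)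
    moreover have "B' \<in> I" using that by (simp add: bases_iff)
    ultimately obtain y where "y \<in> B' - (B - {b})" "insert y (B - {b}) \<in> I"
      using augment[of "B - {b}" B'] by blast
    then show ?thesis unfolding fundamental_cocircuit_def by blast
  qed
  show "\<exists>B' \<in> bases I. B' \<inter> ?D = {d}" if d: "d \<in> ?D" for d
  proof
    show "insert d (B - {b}) \<in> bases I"
      using exchange_is_base[OF B, of d] d unfolding fundamental_cocircuit_def by blast
    show "insert d (B - {b}) \<inter> ?D = {d}"
      using d unfolding fundamental_cocircuit_def by blast
  qed
qed

lemma mem_fundamental_cocircuit:
  "B \<in> I \<Longrightarrow> b \<in> B \<Longrightarrow> b \<in> fundamental_cocircuit B b"
  unfolding fundamental_cocircuit_def by (simp add: insert_absorb)

text \<open>Submodularity of the rank. Extend a maximal independent subset \<open>X\<close> of \<open>S\<close> to one, \<open>Y\<close>, of \<open>T\<close>: if \<open>i\<close> can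
  be added to \<open>Y\<close>, it can be added to \<open>X\<close>.\<close>
lemma rk_marginal_antimono:
  assumes "S \<subseteq> T" "i \<notin> T"
  shows "rk (insert i T) + rk S \<le> rk (insert i S) + rk T"
proof -
  obtain X where X: "X \<in> I" "X \<subseteq> S" "card X = rk S" using rk_attained by blast
  obtain Y where Y: "Y \<in> I" "X \<subseteq> Y" "Y \<subseteq> T" "card Y = rk T"
    using extend_indep[of X T] X assms by blast
  have "insert i Y \<in> I \<Longrightarrow> insert i X \<in> I" using indep_mono[of "insert i Y" "insert i X"] Y by blast
  moreover have "rk (insert i S) = (if insert i X \<in> I then Suc (rk S) else rk S)"
    by (rule rk_insert[OF X]) (use assms in auto)
  moreover have "rk (insert i T) = (if insert i Y \<in> I then Suc (rk T) else rk T)"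
    by (rule rk_insert) (use Y assms in auto)
  ultimately show ?thesis by auto
qed

lemma rk_insert_le: "rk (insert i S) \<le> Suc (rk S)"
proof (cases "i \<in> S")
  case False
  then show ?thesis using rk_attained[of S] rk_insert[of _ S i] by (auto split: if_splits)
qed (auto simp: insert_absorb)

text \<open>In terms of flats: the span of \<open>S\<close> omits \<open>i\<close>, so it lies in a hyperplane omitting \<open>i\<close>; this
  hyperplane cannot contain \<open>T\<close>, whose span contains \<open>i\<close>, and its complement is the cocircuit. The
  hyperplane is taken to be spanned by \<open>B - {i}\<close>, where the basis \<open>B\<close> contains \<open>i\<close> and a maximal independent
  subset of \<open>S\<close>.\<close>
lemma separating_cocircuit:
  assumes ST: "S \<subseteq> T" and iT: "i \<notin> T"
    and S: "rk (insert i S) \<noteq> rk S" and T: "rk (insert i T) = rk T"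
  shows "\<exists>D \<in> cocircuits E I. i \<in> D \<and> D \<inter> S = {} \<and> D \<inter> T \<noteq> {}"
proof -
  obtain X where X: "X \<in> I" "X \<subseteq> S" "card X = rk S" using rk_attained by blast
  have iS: "i \<notin> S" using ST iT by auto
  have Xi: "insert i X \<in> I" using rk_insert[OF X iS] S by (auto split: if_splits)
  obtain B where B: "B \<in> bases I" "insert i X \<subseteq> B" using extend_to_base[OF Xi] by blast
  have BI: "B \<in> I" using B base_indep by blast
  define H where "H = B - {i}"
  have HI: "H \<in> I" using BI indep_mono H_def by blast
  have BH: "B = insert i H" "i \<notin> H" using B H_def by auto
  let ?D = "fundamental_cocircuit B i"
  have mem: "x \<in> ?D \<longleftrightarrow> x \<notin> H \<and> insert x H \<in> I" for x
    by (simp add: fundamental_cocircuit_def H_def)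
  have "?D \<inter> S = {}"
  proof (rule ccontr)
    assume "?D \<inter> S \<noteq> {}"
    then obtain s where s: "s \<in> S" "s \<notin> H" "insert s H \<in> I" using mem by auto
    have XH: "X \<subseteq> H" using B(2) X iS H_def by auto
    then have "insert s X \<in> I" using s indep_mono[of "insert s H" "insert s X"] by blast
    then have "card (insert s X) \<le> rk S" using s X by (intro card_le_rk) auto
    moreover have "s \<notin> X" using s XH by auto
    ultimately show False using X finite_indep[of X] by simp
  qed
  moreover have "?D \<inter> T \<noteq> {}"
  proof
    assume disj: "?D \<inter> T = {}"
    let ?U = "H \<union> T"
    have rkU: "rk ?U = card H"
    proof -
      obtain Z where Z: "Z \<in> I" "H \<subseteq> Z" "Z \<subseteq> ?U" "card Z = rk ?U"
        using extend_indep[OF HI, of ?U] by blast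
      have "Z = H"
      proof (rule ccontr)
        assume "Z \<noteq> H"
        then obtain z where "z \<in> Z" "z \<notin> H" using Z by auto
        moreover from this have "insert z H \<in> I" using Z indep_mono[of Z "insert z H"] by blast
        ultimately show False using disj mem[of z] Z by auto
      qed
      then show ?thesis using Z by simp
    qed
    have iU: "i \<notin> ?U" using BH iT by auto
    have "card B \<le> rk (insert i ?U)" using BI BH by (intro card_le_rk) auto
    then have gt: "rk ?U < rk (insert i ?U)" using BH rkU finite_indep[OF HI] by simp
    have "rk (insert i ?U) + rk T \<le> rk (insert i T) + rk ?U"
      by (rule rk_marginal_antimono) (use iU in auto)
    then show False using gt T by auto
  qed
  moreover have "i \<in> ?D" using mem_fundamental_cocircuit BI BH by auto
  ultimately show ?thesis using fundamental_cocircuit[OF B(1), of i] BH by blast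
qed

section \<open>Circuits and connectivity\<close>

lemma dependent_has_circuit:
  assumes "X \<subseteq> E" "X \<notin> I"
  shows "\<exists>C \<in> circuits E I. C \<subseteq> X"
proof -
  have "finite X" using assms finite_ground finite_subset by blast
  then show ?thesis using assms
  proof (induction X rule: finite_psubset_induct)
    case (psubset X)
    show ?case
    proof (cases "\<forall>Y. Y \<subset> X \<longrightarrow> Y \<in> I")
      case True
      then show ?thesis using psubset.prems by (auto simp: circuits_def)
    next
      case False
      then obtain Y where "Y \<subset> X" "Y \<notin> I" by auto
      then show ?thesis using psubset by (meson order_trans psubset_imp_subset)
    qed
  qed
qed

lemma circuit_delete_indep: "C \<in> circuits E I \<Longrightarrow> c \<in> C \<Longrightarrow> C - {c} \<in> I"
  by (auto simp: circuits_def)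

lemma circuit_antichain: "C \<in> circuits E I \<Longrightarrow> C' \<in> circuits E I \<Longrightarrow> C \<subseteq> C' \<Longrightarrow> C = C'"
  unfolding circuits_def by blast

lemma circuit_spans:
  assumes C: "C \<in> circuits E I" "a \<in> C" and S: "C - {a} \<subseteq> S"
  shows "rk (insert a S) = rk S"
proof (cases "a \<in> S")
  case False
  obtain X where X: "X \<in> I" "C - {a} \<subseteq> X" "X \<subseteq> S" "card X = rk S"
    using extend_indep[OF circuit_delete_indep[OF C] S] by blast
  have "insert a X \<notin> I" using X C indep_mono[of "insert a X" C] by (auto simp: circuits_def)
  then show ?thesis using rk_insert[of X S a] X False by auto
qed (simp add: insert_absorb)

lemma spanned_in_circuit:
  assumes "a \<in> E" "a \<notin> S" "rk (insert a S) = rk S"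
  shows "\<exists>C \<in> circuits E I. a \<in> C \<and> C \<subseteq> insert a S"
proof -
  obtain X where X: "X \<in> I" "X \<subseteq> S" "card X = rk S" using rk_attained by blast
  have "insert a X \<notin> I" using rk_insert[OF X assms(2)] assms(3) by auto
  then obtain C where C: "C \<in> circuits E I" "C \<subseteq> insert a X"
    using dependent_has_circuit[of "insert a X"] X indep_subset_ground assms by blast
  then have "a \<in> C" using X indep_mono[of X C] by (auto simp: circuits_def)
  then show ?thesis using C X by blast
qed

text \<open>Put \<open>S = C1 \<union> C2 - {a, f}\<close>. The circuit \<open>C2\<close>, which omits \<open>a\<close>, shows that \<open>S\<close> spans \<open>f\<close>, and then \<open>C1\<close> shows
  that \<open>insert f S\<close> spans \<open>a\<close>. So \<open>S\<close> itself spans \<open>a\<close>, which produces a circuit through \<open>a\<close>.\<close>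
lemma strong_circuit_elimination:
  assumes C: "C1 \<in> circuits E I" "C2 \<in> circuits E I"
    and f: "f \<in> C1 \<inter> C2" and a: "a \<in> C1 - C2"
  shows "\<exists>C3 \<in> circuits E I. a \<in> C3 \<and> C3 \<subseteq> C1 \<union> C2 - {f}"
proof -
  let ?S = "C1 \<union> C2 - {a, f}"
  have "rk (insert f ?S) = rk ?S" using C f a by (intro circuit_spans[of C2]) auto
  moreover have "rk (insert a (insert f ?S)) = rk (insert f ?S)"
    using C f a by (intro circuit_spans[of C1]) auto
  moreover have "rk (insert a ?S) \<le> rk (insert a (insert f ?S))" by (intro rk_mono) auto
  moreover have "rk ?S \<le> rk (insert a ?S)" by (intro rk_mono) auto
  ultimately have "rk (insert a ?S) = rk ?S" by auto
  moreover have "a \<in> E" using C a by (auto simp: circuits_def)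
  ultimately obtain C3 where "C3 \<in> circuits E I" "a \<in> C3" "C3 \<subseteq> insert a ?S"
    using spanned_in_circuit[of a ?S] by auto
  then show ?thesis using f a by (intro bexI[of _ C3]) auto
qed

text \<open>Induction on the union of the two circuits. If no circuit contains both \<open>a\<close> and \<open>c\<close>, eliminate a
  common element \<open>f\<close> in two ways, obtaining a circuit \<open>C3\<close> through \<open>a\<close> and a circuit \<open>C4\<close> through \<open>c\<close>, both
  avoiding \<open>f\<close>. The pair \<open>C3\<close>, \<open>C2\<close> meets, so by minimality it has the same union as \<open>C1\<close>, \<open>C2\<close>, whence
  \<open>C1 - C2 \<subseteq> C3\<close>. As \<open>C4\<close> meets \<open>C1 - C2\<close>, the circuits \<open>C3\<close> and \<open>C4\<close> meet as well, but their union is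
  smaller because it misses \<open>f\<close>.\<close>
lemma common_circuit_trans:
  assumes "C1 \<in> circuits E I" "C2 \<in> circuits E I" "a \<in> C1" "c \<in> C2" "C1 \<inter> C2 \<noteq> {}"
  shows "\<exists>C \<in> circuits E I. a \<in> C \<and> c \<in> C"
proof -
  have "finite (C1 \<union> C2)"
    using assms(1,2) finite_ground by (auto simp: circuits_def intro: finite_subset)
  then show ?thesis using assms
  proof (induction "C1 \<union> C2" arbitrary: C1 C2 rule: finite_psubset_induct)
    case psubset
    note C1 = \<open>C1 \<in> circuits E I\<close> and C2 = \<open>C2 \<in> circuits E I\<close>
      and a = \<open>a \<in> C1\<close> and c = \<open>c \<in> C2\<close>
    show ?case
    proof (rule ccontr)
      assume no: "\<not> ?thesis"
      obtain f where f: "f \<in> C1 \<inter> C2" using psubset.prems by blast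
      have "a \<notin> C2" "c \<notin> C1" using no C1 C2 a c by blast+
      obtain C3 where C3: "C3 \<in> circuits E I" "a \<in> C3" "C3 \<subseteq> C1 \<union> C2 - {f}"
        using strong_circuit_elimination[OF C1 C2 f] a \<open>a \<notin> C2\<close> by blast
      obtain C4 where C4: "C4 \<in> circuits E I" "c \<in> C4" "C4 \<subseteq> C2 \<union> C1 - {f}"
        using strong_circuit_elimination[OF C2 C1, of f c] f c \<open>c \<notin> C1\<close> by blast
      have "\<not> C3 \<subseteq> C1" using circuit_antichain[OF C3(1) C1] C3 f by blast
      then have C32: "C3 \<inter> C2 \<noteq> {}" using C3 by blast
      have "\<not> C4 \<subseteq> C2" using circuit_antichain[OF C4(1) C2] C4 f by blast
      then obtain g where g: "g \<in> C4" "g \<in> C1 - C2" using C4 by blast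
      have "\<not> C3 \<union> C2 \<subset> C1 \<union> C2"
        using psubset.hyps(2)[of C3 C2] C3 C2 c C32 no by blast
      then have "g \<in> C3" using C3 g by blast
      then have "C3 \<inter> C4 \<noteq> {}" using g by blast
      moreover have "C3 \<union> C4 \<subset> C1 \<union> C2" using C3 C4 f by blast
      ultimately show False
        using psubset.hyps(2)[of C3 C4] C3 C4 no by blast
    qed
  qed
qed

lemma equiv_matroid_conn: "equiv E (matroid_conn E I)"
proof (rule equivI)
  show "matroid_conn E I \<subseteq> E \<times> E" by (auto simp: matroid_conn_def)
  show "refl_on E (matroid_conn E I)" by (auto simp: refl_on_def matroid_conn_def)
  show "sym (matroid_conn E I)" by (auto simp: sym_def matroid_conn_def)
  show "trans (matroid_conn E I)"
  proof (rule transI)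
    fix a b c assume ab: "(a, b) \<in> matroid_conn E I" and bc: "(b, c) \<in> matroid_conn E I"
    then consider "a = b \<or> b = c" | C1 C2 where "C1 \<in> circuits E I" "C2 \<in> circuits E I"
        "a \<in> C1" "b \<in> C1" "b \<in> C2" "c \<in> C2"
      unfolding matroid_conn_def by blast
    then show "(a, c) \<in> matroid_conn E I"
    proof cases
      case 1
      then show ?thesis using ab bc by auto
    next
      case 2
      then have "\<exists>C \<in> circuits E I. a \<in> C \<and> c \<in> C"
        by (intro common_circuit_trans[of C1 C2]) auto
      then show ?thesis using ab bc by (auto simp: matroid_conn_def)
    qed
  qed
qed

text \<open>Replacing \<open>b\<close> by \<open>a\<close> keeps the rank: \<open>B - {b}\<close> together with \<open>a\<close> spans \<open>b\<close> through \<open>C\<close>, so it spans \<open>B\<close>.\<close>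
lemma circuit_exchange:
  assumes B: "B \<in> bases I" and C: "C \<in> circuits E I" "a \<in> C" "b \<in> C" "a \<noteq> b" "C - {a} \<subseteq> B"
  shows "a \<notin> B" "b \<in> B" "insert a (B - {b}) \<in> I"
proof -
  have BI: "B \<in> I" "card B = rk E" using B by (simp_all add: bases_iff)
  have fB: "finite B" using BI finite_indep by auto
  show aB: "a \<notin> B" using BI C indep_mono[of B C] by (auto simp: circuits_def)
  show bB: "b \<in> B" using C by auto
  let ?S = "B - {b}"
  have "rk (insert b (insert a ?S)) = rk (insert a ?S)"
    using C by (intro circuit_spans[of C]) auto
  moreover have "card B \<le> rk (insert b (insert a ?S))" using BI by (intro card_le_rk) auto
  ultimately have ge: "card B \<le> rk (insert a ?S)" by simp
  have SI: "?S \<in> I" using BI indep_mono by blast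
  have "rk ?S = card ?S" by (rule rk_indep[OF SI])
  moreover have "card ?S < card B" using fB bB card_Diff1_less[of B b] by simp
  ultimately show "insert a ?S \<in> I"
    using rk_insert[OF SI order_refl, of a] aB ge by (auto split: if_splits)
qed

text \<open>The complement of a cocircuit \<open>D\<close> contains no basis, but adding any \<open>d \<in> D\<close> yields one, so it does not
  span \<open>d\<close>. A circuit meeting \<open>D\<close> only in \<open>d\<close> would make it span \<open>d\<close>.\<close>
lemma circuit_cocircuit_orthogonal:
  assumes C: "C \<in> circuits E I" and D: "D \<in> cocircuits E I"
  shows "C \<inter> D \<noteq> {d}"
proof
  assume CD: "C \<inter> D = {d}"
  then have d: "d \<in> C" "d \<in> D" by auto
  obtain B where B: "B \<in> bases I" "B \<inter> D = {d}" using cocircuit_private_base[OF D d(2)] by blast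
  have BI: "B \<in> I" "card B = rk E" using B by (simp_all add: bases_iff)
  have "rk (insert d (E - D)) = rk (E - D)"
    using C CD d by (intro circuit_spans) (auto simp: circuits_def)
  moreover have "card B \<le> rk (insert d (E - D))"
    using BI B indep_subset_ground[of B] by (intro card_le_rk) auto
  ultimately have ge: "rk E \<le> rk (E - D)" using BI by simp
  obtain X where X: "X \<in> I" "X \<subseteq> E - D" "card X = rk (E - D)" using rk_attained by blast
  have "X \<in> bases I" using X ge rk_mono[of "E - D" E] by (auto simp: bases_iff)
  then show False using cocircuit_meets_base[OF D] X by blast
qed

lemma fundamental_circuit:
  assumes B: "B \<in> bases I" and a: "a \<in> E" "a \<notin> B"
  shows "\<exists>C \<in> circuits E I. a \<in> C \<and> C \<subseteq> insert a B"
proof -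
  have BI: "B \<in> I" "B \<subseteq> E" using base_indep[OF B] indep_subset_ground by auto
  have "insert a B \<notin> I" using B a unfolding bases_def by blast
  then obtain C where C: "C \<in> circuits E I" "C \<subseteq> insert a B"
    using dependent_has_circuit[of "insert a B"] a BI by blast
  moreover have "a \<in> C" using C BI indep_mono[of B C] by (auto simp: circuits_def)
  ultimately show ?thesis by blast
qed

text \<open>Both sides express that some basis contains exactly one of \<open>a\<close>, \<open>b\<close> and remains a basis when that
  one is replaced by the other. From a circuit, the fundamental cocircuit of \<open>b\<close> for a basis containing
  \<open>C - {a}\<close> contains \<open>a\<close>; from a cocircuit, the fundamental circuit of \<open>b\<close> for a basis meeting \<open>D\<close> only in
  \<open>a\<close> contains \<open>a\<close> by orthogonality.\<close>
lemma common_circuit_iff_common_cocircuit: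
  assumes "a \<noteq> b"
  shows "(\<exists>C \<in> circuits E I. a \<in> C \<and> b \<in> C) \<longleftrightarrow> (\<exists>D \<in> cocircuits E I. a \<in> D \<and> b \<in> D)"
proof
  assume "\<exists>C \<in> circuits E I. a \<in> C \<and> b \<in> C"
  then obtain C where C: "C \<in> circuits E I" "a \<in> C" "b \<in> C" by blast
  obtain B where B: "B \<in> bases I" "C - {a} \<subseteq> B"
    using extend_to_base circuit_delete_indep[OF C(1,2)] by blast
  note ex = circuit_exchange[OF B(1) C assms B(2)]
  have "B \<in> I" using B base_indep by blast
  moreover have "a \<in> fundamental_cocircuit B b"
    using ex unfolding fundamental_cocircuit_def by blast
  ultimately show "\<exists>D \<in> cocircuits E I. a \<in> D \<and> b \<in> D"
    using fundamental_cocircuit[OF B(1) ex(2)] mem_fundamental_cocircuit ex(2) by blast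
next
  assume "\<exists>D \<in> cocircuits E I. a \<in> D \<and> b \<in> D"
  then obtain D where D: "D \<in> cocircuits E I" "a \<in> D" "b \<in> D" by blast
  obtain B where B: "B \<in> bases I" "B \<inter> D = {a}" using cocircuit_private_base[OF D(1,2)] by blast
  have "b \<in> E" using D cocircuit_subset_ground by blast
  moreover have "b \<notin> B" using B D assms by auto
  ultimately obtain C where C: "C \<in> circuits E I" "b \<in> C" "C \<subseteq> insert b B"
    using fundamental_circuit[OF B(1)] by blast
  have "C \<inter> D \<subseteq> {a, b}" "b \<in> C \<inter> D" using B C D by auto
  then have "a \<in> C" using circuit_cocircuit_orthogonal[OF C(1) D(1), of b] by auto
  then show "\<exists>C \<in> circuits E I. a \<in> C \<and> b \<in> C" using C by blast
qed

text \<open>If \<open>d\<close> is outside \<open>B\<close>, its fundamental circuit meets \<open>D\<close> in a second element \<open>e\<close> by orthogonality.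
  Exchanging \<open>e\<close> for \<open>d\<close> gives a basis, whose weight cannot exceed that of \<open>B\<close>.\<close>
lemma cocircuit_meets_max_weight_base:
  fixes w :: "'a \<Rightarrow> real"
  assumes B: "B \<in> bases I" and max: "\<And>B'. B' \<in> bases I \<Longrightarrow> sum w B' \<le> sum w B"
    and D: "D \<in> cocircuits E I" "d \<in> D"
  shows "\<exists>e \<in> D \<inter> B. w d \<le> w e"
proof (cases "d \<in> B")
  case False
  have "d \<in> E" using D cocircuit_subset_ground by blast
  then obtain C where C: "C \<in> circuits E I" "d \<in> C" "C \<subseteq> insert d B"
    using fundamental_circuit[OF B] False by blast
  obtain e where e: "e \<in> C" "e \<in> D" "e \<noteq> d"
    using circuit_cocircuit_orthogonal[OF C(1) D(1), of d] C D by auto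
  then have eB: "e \<in> B" using C by auto
  have "insert d (B - {e}) \<in> I"
    using circuit_exchange(3)[OF B C(1,2) e(1)] e C by auto
  then have "sum w (insert d (B - {e})) \<le> sum w B"
    using exchange_is_base[OF B eB, of d] False by (intro max) auto
  moreover have "finite B" using B base_indep finite_indep by blast
  ultimately have "w d \<le> w e" using eB False by (simp add: sum_diff1)
  then show ?thesis using e eB by blast
qed (use D in auto)

end

section \<open>Base polytopes and greedy vectors\<close>

definition base_polytope :: "('n set \<Rightarrow> real) \<Rightarrow> (real ^ 'n::finite) set" where
  "base_polytope f = {x. (\<Sum>i\<in>UNIV. x $ i) = f UNIV \<and> (\<forall>S. (\<Sum>i\<in>S. x $ i) \<le> f S)}"

text \<open>The head of the list is the element added last. Recursion on the list then adds elements to the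
  set of the remaining ones, so that no accumulator is needed. The list may omit elements, whose
  coordinates are then zero.\<close>
primrec greedy_vec :: "('n set \<Rightarrow> real) \<Rightarrow> 'n list \<Rightarrow> real ^ 'n::finite" where
  "greedy_vec f [] = 0"
| "greedy_vec f (i # xs) = axis i (f (insert i (set xs)) - f (set xs)) + greedy_vec f xs"

lemma greedy_vec_nth_outside: "j \<notin> set xs \<Longrightarrow> greedy_vec f xs $ j = 0"
  by (induction xs) (auto simp: axis_def)

lemma greedy_vec_add:
  "greedy_vec (\<lambda>S. f S + g S) xs = greedy_vec f xs + greedy_vec g xs"
  by (induction xs) (auto simp: vec_eq_iff axis_def)

lemma greedy_vec_sum:
  "greedy_vec (\<lambda>S. \<Sum>d\<in>A. f d S) xs = (\<Sum>d\<in>A. greedy_vec (f d) xs)"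
proof (induction xs)
  case (Cons i xs)
  have "axis i ((\<Sum>d\<in>A. f d (insert i (set xs))) - (\<Sum>d\<in>A. f d (set xs)))
      = (\<Sum>d\<in>A. axis i (f d (insert i (set xs)) - f d (set xs)) :: real ^ 'a)"
    by (simp add: vec_eq_iff axis_def sum_subtractf)
  with Cons show ?case by (simp add: sum.distrib)
qed simp

lemma sum_axis_nth:
  fixes i :: "'n::finite"
  shows "(\<Sum>j\<in>S. (axis i c :: real ^ 'n) $ j) = (if i \<in> S then c else 0)"
  by (simp add: axis_def sum.delta if_distrib cong: if_cong)

lemma greedy_vec_total:
  "(\<Sum>j\<in>UNIV. greedy_vec f xs $ j) = f (set xs) - f {}"
  by (induction xs) (auto simp: sum.distrib sum_axis_nth)

text \<open>The marginal of \<open>i\<close> over all elements added before is at most its marginal over those of them that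
  lie in \<open>S\<close>; the latter marginals telescope to the bound.\<close>
lemma greedy_vec_le:
  fixes g :: "'n::finite set \<Rightarrow> real"
  assumes sub: "\<And>S T i. S \<subseteq> T \<Longrightarrow> i \<notin> T \<Longrightarrow> g (insert i T) + g S \<le> g (insert i S) + g T"
    and "distinct xs"
  shows "(\<Sum>j\<in>S. greedy_vec g xs $ j) \<le> g (S \<inter> set xs) - g {}"
  using assms(2)
proof (induction xs)
  case (Cons i xs)
  show ?case
  proof (cases "i \<in> S")
    case True
    have "g (insert i (set xs)) + g (S \<inter> set xs) \<le> g (insert i (S \<inter> set xs)) + g (set xs)"
      using Cons by (intro sub) auto
    moreover have "S \<inter> set (i # xs) = insert i (S \<inter> set xs)" using True by auto
    ultimately show ?thesis using Cons True by (simp add: sum.distrib sum_axis_nth)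
  next
    case False
    then have "S \<inter> set (i # xs) = S \<inter> set xs" by auto
    then show ?thesis using Cons False by (simp add: sum.distrib sum_axis_nth)
  qed
qed simp

lemma ex_sorted_enumeration:
  fixes w :: "'a \<Rightarrow> real"
  assumes "finite A"
  shows "\<exists>xs. distinct xs \<and> set xs = A \<and> sorted_wrt (\<lambda>i j. w i \<le> w j) xs"
proof -
  obtain ys where ys: "set ys = A" "distinct ys" using finite_distinct_list[OF assms] by blast
  have "sorted_wrt (\<lambda>i j. w i \<le> w j) (sort_key w ys)"
    using sorted_sort_key[of w ys] by (simp add: sorted_map)
  then show ?thesis using ys by (intro exI[of _ "sort_key w ys"]) simp
qed

text \<open>Abel summation: with weights \<open>c \<le> w\<^sub>1 \<le> w\<^sub>2 \<le> \<dots>\<close> along the list, the left-hand side is a combination of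
  the coordinate sums over the tails of the list with the nonnegative coefficients
  \<open>w\<^sub>1 - c, w\<^sub>2 - w\<^sub>1, \<dots>\<close>, and the greedy vector attains the bound \<open>f\<close> on each of these tails. The lower bound \<open>c\<close>
  is what the induction varies.\<close>
lemma greedy_vec_maximizes:
  fixes x :: "real ^ 'n::finite" and w :: "'n \<Rightarrow> real"
  assumes "\<And>S. (\<Sum>i\<in>S. x $ i) \<le> f S" and f0: "f {} = 0"
    and "distinct xs" "sorted_wrt (\<lambda>i j. w i \<le> w j) xs" "\<forall>i \<in> set xs. c \<le> w i"
  shows "(\<Sum>j\<in>set xs. (w j - c) * x $ j) \<le> (\<Sum>j\<in>set xs. (w j - c) * greedy_vec f xs $ j)"
  using assms(3-5)
proof (induction xs arbitrary: c)
  case (Cons i xs)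
  let ?g = "greedy_vec f (i # xs)"
  have i: "i \<notin> set xs" using Cons.prems by simp
  have g_eq: "?g $ j = greedy_vec f xs $ j" if "j \<in> set xs" for j
    using that i by (auto simp: axis_def)
  \<comment> \<open>Lowering the offset from the smallest weight to \<open>c\<close> only adds a multiple of the coordinate sum.\<close>
  have split: "(\<Sum>j\<in>set (i # xs). (w j - c) * y $ j)
      = (\<Sum>j\<in>set xs. (w j - w i) * y $ j) + (w i - c) * (\<Sum>j\<in>set (i # xs). y $ j)"
    for y :: "real ^ 'n"
  proof -
    have "(\<Sum>j\<in>set xs. (w j - c) * y $ j)
        = (\<Sum>j\<in>set xs. (w j - w i) * y $ j) + (w i - c) * (\<Sum>j\<in>set xs. y $ j)"
      by (simp add: sum_distrib_left sum.distrib[symmetric] algebra_simps)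
    then show ?thesis using i by (simp add: algebra_simps)
  qed
  have "(\<Sum>j\<in>set (i # xs). ?g $ j) = (\<Sum>j\<in>UNIV. ?g $ j)"
    by (rule sum.mono_neutral_left) (auto intro: greedy_vec_nth_outside simp del: greedy_vec.simps)
  then have tot: "(\<Sum>j\<in>set (i # xs). ?g $ j) = f (set (i # xs))"
    using greedy_vec_total[of f "i # xs"] f0 by simp
  have "(\<Sum>j\<in>set xs. (w j - w i) * x $ j) \<le> (\<Sum>j\<in>set xs. (w j - w i) * greedy_vec f xs $ j)"
    using Cons.prems by (intro Cons.IH) auto
  moreover have "\<dots> = (\<Sum>j\<in>set xs. (w j - w i) * ?g $ j)"
    by (rule sum.cong) (simp_all only: g_eq)
  moreover have "(w i - c) * (\<Sum>j\<in>set (i # xs). x $ j) \<le> (w i - c) * (\<Sum>j\<in>set (i # xs). ?g $ j)"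
    unfolding tot using Cons.prems by (intro mult_left_mono assms(1)) auto
  ultimately show ?case unfolding split[of x] split[of ?g] by linarith
qed simp

text \<open>A point outside the hull is strictly separated from it by some functional.\<close>
lemma mem_convex_hull_if_dominated:
  fixes x :: "'a::euclidean_space"
  assumes "finite V" and dom: "\<And>w. \<exists>v \<in> V. w \<bullet> x \<le> w \<bullet> v"
  shows "x \<in> convex hull V"
proof (rule ccontr)
  assume "x \<notin> convex hull V"
  moreover have "closed (convex hull V)"
    using assms(1) by (simp add: compact_imp_closed finite_imp_compact_convex_hull)
  ultimately obtain a b where ab: "a \<bullet> x < b" "\<forall>y \<in> convex hull V. b < a \<bullet> y"
    using separating_hyperplane_closed_point[of "convex hull V" x] by auto
  obtain v where "v \<in> V" "(- a) \<bullet> x \<le> (- a) \<bullet> v" using dom by blast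
  then show False using ab hull_inc[of v V convex] by fastforce
qed

lemma base_polytope_subset_hull:
  fixes f :: "'n::finite set \<Rightarrow> real"
  assumes f0: "f {} = 0"
  shows "base_polytope f \<subseteq> convex hull (greedy_vec f ` permutations_of_set UNIV)"
proof
  fix x assume x: "x \<in> base_polytope f"
  show "x \<in> convex hull (greedy_vec f ` permutations_of_set UNIV)"
  proof (rule mem_convex_hull_if_dominated)
    fix w :: "real ^ 'n"
    obtain xs where xs: "distinct xs" "set xs = UNIV" "sorted_wrt (\<lambda>i j. w $ i \<le> w $ j) xs"
      using ex_sorted_enumeration[of UNIV "\<lambda>i. w $ i"] by auto
    \<comment> \<open>Any lower bound of the weights serves: the two points have equal coordinate sums, so \<open>c\<close> cancels.\<close>
    define c where "c = Min (range (\<lambda>i. w $ i))"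
    let ?g = "greedy_vec f xs"
    have "(\<Sum>j\<in>UNIV. (w $ j - c) * x $ j) \<le> (\<Sum>j\<in>UNIV. (w $ j - c) * ?g $ j)"
      using greedy_vec_maximizes[of x f xs "\<lambda>i. w $ i" c] x xs f0
      by (auto simp: base_polytope_def c_def)
    moreover have "(\<Sum>j\<in>UNIV. (w $ j - c) * y $ j) = w \<bullet> y - c * (\<Sum>j\<in>UNIV. y $ j)"
      for y :: "real ^ 'n"
      by (simp add: inner_vec_def left_diff_distrib sum_subtractf sum_distrib_left)
    moreover have "(\<Sum>j\<in>UNIV. x $ j) = (\<Sum>j\<in>UNIV. ?g $ j)"
      using x xs f0 by (simp add: base_polytope_def greedy_vec_total)
    ultimately have "w \<bullet> x \<le> w \<bullet> ?g" by simp
    moreover have "xs \<in> permutations_of_set UNIV" using xs by auto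
    ultimately show "\<exists>v \<in> greedy_vec f ` permutations_of_set UNIV. w \<bullet> x \<le> w \<bullet> v" by blast
  qed simp
qed

section \<open>Minkowski sums of simplices\<close>

text \<open>For nonempty \<open>D\<close>, the maximum over \<open>simplex_on D\<close> of the coordinate sum over \<open>S\<close>.\<close>
definition hits :: "'n set \<Rightarrow> 'n set \<Rightarrow> real" where
  "hits D S = (if D \<inter> S = {} then 0 else 1)"

definition hit_count :: "'n set set \<Rightarrow> 'n set \<Rightarrow> real" where
  "hit_count F S = (\<Sum>D\<in>F. hits D S)"

lemma hit_count_eq_card:
  assumes "finite F"
  shows "hit_count F S = real (card {D \<in> F. D \<inter> S \<noteq> {}})"
proof -
  have "hit_count F S = (\<Sum>D\<in>F. if D \<inter> S \<noteq> {} then 1 else 0)"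
    unfolding hit_count_def hits_def by (rule sum.cong) auto
  then show ?thesis using assms by (simp add: sum.If_cases Int_def)
qed

text \<open>The gain in the marginal of \<open>i\<close> from \<open>T\<close> to \<open>S\<close>, which is one exactly if \<open>D\<close> contains \<open>i\<close>, avoids \<open>S\<close> and
  meets \<open>T\<close>.\<close>
lemma hits_marginal:
  assumes "S \<subseteq> T"
  shows "hits D (insert i T) + hits D S + (if i \<in> D \<and> D \<inter> S = {} \<and> D \<inter> T \<noteq> {} then 1 else 0)
    \<le> hits D (insert i S) + hits D T"
  using assms by (auto simp: hits_def)

lemma greedy_vec_hits_disjoint: "D \<inter> set xs = {} \<Longrightarrow> greedy_vec (hits D) xs = 0"
  by (induction xs) (auto simp: hits_def vec_eq_iff axis_def)

text \<open>Only the first element of \<open>D\<close> to be added, that is the last one in the list, changes \<open>hits D\<close>. In a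
  list of increasing weight it is the heaviest listed element of \<open>D\<close>.\<close>
lemma greedy_vec_hits:
  fixes D :: "'n::finite set"
  assumes "sorted_wrt (\<lambda>i j. w i \<le> (w j :: real)) xs" "D \<inter> set xs \<noteq> {}"
  shows "\<exists>m \<in> D \<inter> set xs. greedy_vec (hits D) xs = axis m 1 \<and> (\<forall>e \<in> D \<inter> set xs. w e \<le> w m)"
  using assms
proof (induction xs)
  case (Cons i xs)
  show ?case
  proof (cases "D \<inter> set xs = {}")
    case True
    then have "i \<in> D" using Cons.prems by auto
    moreover have "D \<inter> set (i # xs) = {i}" using True \<open>i \<in> D\<close> by auto
    moreover have "greedy_vec (hits D) (i # xs) = axis i 1"
      using True \<open>i \<in> D\<close> by (simp add: greedy_vec_hits_disjoint hits_def)
    ultimately show ?thesis by auto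
  next
    case False
    then obtain m where m: "m \<in> D \<inter> set xs" "greedy_vec (hits D) xs = axis m 1"
      "\<forall>e \<in> D \<inter> set xs. w e \<le> w m" using Cons by auto
    have "greedy_vec (hits D) (i # xs) = axis m 1"
      using False m by (auto simp: hits_def axis_def vec_eq_iff)
    moreover have "w i \<le> w m" using Cons.prems m by auto
    ultimately show ?thesis using m by (intro bexI[of _ m]) auto
  qed
qed simp

lemma greedy_vec_hit_count: "greedy_vec (hit_count F) xs = (\<Sum>D\<in>F. greedy_vec (hits D) xs)"
  unfolding hit_count_def[abs_def] by (rule greedy_vec_sum)

lemma axis_in_simplex: "i \<in> D \<Longrightarrow> axis i 1 \<in> simplex_on D"
  unfolding simplex_on_def by (rule hull_inc) auto

lemma greedy_vec_hits_in_simplex: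
  assumes "D \<inter> set xs \<noteq> {}"
  shows "greedy_vec (hits D) xs \<in> simplex_on D"
proof -
  have "sorted_wrt (\<lambda>i j. (0::real) \<le> 0) xs" by (induction xs) auto
  then show ?thesis using greedy_vec_hits[of "\<lambda>_. 0" xs D] assms axis_in_simplex by fastforce
qed

lemma simplex_on_le_hits:
  fixes x :: "real ^ 'n::finite"
  assumes x: "x \<in> simplex_on D"
  shows "(\<Sum>i\<in>S. x $ i) \<le> hits D S" and "(\<Sum>i\<in>UNIV. x $ i) = 1"
proof -
  let ?K = "{y :: real ^ 'n. (\<forall>i. 0 \<le> y $ i) \<and> (\<forall>i. i \<notin> D \<longrightarrow> y $ i = 0) \<and> (\<Sum>i\<in>UNIV. y $ i) = 1}"
  have "convex ?K"
  proof (rule convexI)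
    fix y z :: "real ^ 'n" and u v :: real
    assume yz: "y \<in> ?K" "z \<in> ?K" and uv: "0 \<le> u" "0 \<le> v" "u + v = 1"
    have "(\<Sum>i\<in>UNIV. (u *\<^sub>R y + v *\<^sub>R z) $ i) = u * (\<Sum>i\<in>UNIV. y $ i) + v * (\<Sum>i\<in>UNIV. z $ i)"
      by (simp add: sum.distrib sum_distrib_left)
    then show "u *\<^sub>R y + v *\<^sub>R z \<in> ?K" using yz uv by simp
  qed
  moreover have "(\<lambda>s. axis s 1) ` D \<subseteq> ?K" by (auto simp: sum_axis_nth) (auto simp: axis_def)
  ultimately have "simplex_on D \<subseteq> ?K" unfolding simplex_on_def by (intro hull_minimal)
  with x have K: "x \<in> ?K" by blast
  then show tot: "(\<Sum>i\<in>UNIV. x $ i) = 1" by auto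
  have out: "x $ i = 0" if "i \<notin> D" for i using K that by auto
  show "(\<Sum>i\<in>S. x $ i) \<le> hits D S"
  proof (cases "D \<inter> S = {}")
    case True
    then have "(\<Sum>i\<in>S. x $ i) = 0" using out by (intro sum.neutral) auto
    then show ?thesis using True by (simp add: hits_def)
  next
    case False
    have "(\<Sum>i\<in>S. x $ i) \<le> (\<Sum>i\<in>UNIV. x $ i)" using K by (intro sum_mono2) auto
    then show ?thesis using False tot by (simp add: hits_def)
  qed
qed

lemma convex_sum_simplex_on: "convex (\<Sum>D\<in>F. simplex_on D :: (real ^ 'n::finite) set)"
  by (rule convex_set_sum) (simp add: simplex_on_def)

lemma greedy_vec_hit_count_in_sum:
  fixes F :: "'n::finite set set"
  assumes "\<And>D. D \<in> F \<Longrightarrow> D \<inter> set xs \<noteq> {}"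
  shows "greedy_vec (hit_count F) xs \<in> (\<Sum>D\<in>F. simplex_on D)"
proof -
  have "\<forall>D\<in>F. greedy_vec (hits D) xs \<in> simplex_on D"
    using greedy_vec_hits_in_simplex assms by blast
  then show ?thesis
    unfolding greedy_vec_hit_count set_sum_alt[OF finite]
    by (intro CollectI exI[of _ "\<lambda>D. greedy_vec (hits D) xs"] conjI refl)
qed

text \<open>The simplices satisfy the inequalities for \<open>hits D\<close>, which add up. Conversely the base polytope is
  in the hull of the greedy vectors, and each of these is a sum of vertices of the simplices. The
  empty set has to be excluded, as an empty simplex would make the Minkowski sum empty.\<close>
lemma sum_simplex_on_eq_base_polytope:
  fixes F :: "'n::finite set set"
  assumes ne: "{} \<notin> F"
  shows "(\<Sum>D\<in>F. simplex_on D) = base_polytope (hit_count F)"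
proof
  show "(\<Sum>D\<in>F. simplex_on D) \<subseteq> base_polytope (hit_count F)"
  proof
    fix x :: "real ^ 'n" assume "x \<in> (\<Sum>D\<in>F. simplex_on D)"
    then obtain s where s: "x = sum s F" "\<And>D. D \<in> F \<Longrightarrow> s D \<in> simplex_on D"
      unfolding set_sum_alt[OF finite] by blast
    have swap: "(\<Sum>i\<in>S. x $ i) = (\<Sum>D\<in>F. \<Sum>i\<in>S. s D $ i)" for S
      unfolding s(1) sum_component by (rule sum.swap)
    have "(\<Sum>i\<in>S. x $ i) \<le> hit_count F S" for S
      unfolding swap hit_count_def using s(2) by (intro sum_mono simplex_on_le_hits)
    moreover have "(\<Sum>i\<in>UNIV. x $ i) = hit_count F UNIV"
      unfolding swap hit_count_def
    proof (rule sum.cong)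
      fix D assume "D \<in> F"
      then show "(\<Sum>i\<in>UNIV. s D $ i) = hits D UNIV"
        using simplex_on_le_hits(2)[OF s(2)[of D]] ne by (auto simp: hits_def)
    qed simp
    ultimately show "x \<in> base_polytope (hit_count F)" by (simp add: base_polytope_def)
  qed
  have "base_polytope (hit_count F)
      \<subseteq> convex hull (greedy_vec (hit_count F) ` permutations_of_set UNIV)"
    by (rule base_polytope_subset_hull) (simp add: hit_count_def hits_def)
  also have "\<dots> \<subseteq> (\<Sum>D\<in>F. simplex_on D)"
  proof (intro hull_minimal convex_sum_simplex_on image_subsetI)
    fix xs :: "'n list" assume "xs \<in> permutations_of_set UNIV"
    then have "set xs = UNIV" by (rule permutations_of_setD)
    then show "greedy_vec (hit_count F) xs \<in> (\<Sum>D\<in>F. simplex_on D)"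
      using ne by (intro greedy_vec_hit_count_in_sum) auto
  qed
  finally show "base_polytope (hit_count F) \<subseteq> (\<Sum>D\<in>F. simplex_on D)" .
qed

lemma e_vec_nth: "e_vec S $ j = (if j \<in> S then 1 else 0)"
  by (simp add: e_vec_def axis_def sum.delta)

lemma simplex_sum_memD:
  fixes F :: "'n::finite set set"
  assumes "x \<in> (\<Sum>D\<in>F. simplex_on D)"
  shows "\<exists>s. x = sum s F \<and> (\<forall>D\<in>F. s D \<in> simplex_on D)"
  using assms unfolding set_sum_alt[OF finite] by blast

lemma simplex_sum_memI:
  fixes F :: "'n::finite set set"
  assumes "\<And>D. D \<in> F \<Longrightarrow> s D \<in> simplex_on D"
  shows "sum s F \<in> (\<Sum>D\<in>F. simplex_on D)"
  unfolding set_sum_alt[OF finite] using assms by (intro CollectI exI[of _ s]) simp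

lemma convex_base_polytope: "convex (base_polytope f)"
proof (rule convexI)
  fix y z :: "real ^ 'a" and u v :: real
  assume yz: "y \<in> base_polytope f" "z \<in> base_polytope f" and uv: "0 \<le> u" "0 \<le> v" "u + v = 1"
  have eq: "(\<Sum>i\<in>S. (u *\<^sub>R y + v *\<^sub>R z) $ i) = u * (\<Sum>i\<in>S. y $ i) + v * (\<Sum>i\<in>S. z $ i)" for S
    by (simp add: sum.distrib sum_distrib_left)
  have "u * (\<Sum>i\<in>S. y $ i) + v * (\<Sum>i\<in>S. z $ i) \<le> f S" for S
    by (rule convex_bound_le) (use yz uv in \<open>auto simp: base_polytope_def\<close>)
  moreover have "u * f UNIV + v * f UNIV = f UNIV" using uv by (simp add: distrib_right[symmetric])
  ultimately show "u *\<^sub>R y + v *\<^sub>R z \<in> base_polytope f"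
    using yz unfolding base_polytope_def by (simp only: mem_Collect_eq eq) simp
qed

lemma base_polytope_plus_subset:
  "base_polytope f + base_polytope g \<subseteq> base_polytope (\<lambda>S. f S + g S)"
  by (auto simp: base_polytope_def set_plus_def sum.distrib intro!: add_mono)

text \<open>The half of Edmonds' theorem that needs submodularity; the other half is \<open>base_polytope_subset_hull\<close>.\<close>
lemma submodular_hull_subset_base_polytope:
  fixes g :: "'n::finite set \<Rightarrow> real"
  assumes sub: "\<And>S T i. S \<subseteq> T \<Longrightarrow> i \<notin> T \<Longrightarrow> g (insert i T) + g S \<le> g (insert i S) + g T"
    and g0: "g {} = 0"
  shows "convex hull (greedy_vec g ` permutations_of_set UNIV) \<subseteq> base_polytope g"
proof (intro hull_minimal convex_base_polytope image_subsetI)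
  fix xs :: "'n list" assume xs: "xs \<in> permutations_of_set UNIV"
  have "(\<Sum>j\<in>S. greedy_vec g xs $ j) \<le> g S" for S
    using greedy_vec_le[of g xs S] sub permutations_of_setD[OF xs] g0 by simp
  moreover have "(\<Sum>j\<in>UNIV. greedy_vec g xs $ j) = g UNIV"
    using permutations_of_setD[OF xs] g0 by (simp add: greedy_vec_total)
  ultimately show "greedy_vec g xs \<in> base_polytope g" by (simp add: base_polytope_def)
qed

section \<open>The matroid polytope as a summand of the cocircuit polytope\<close>

context
  fixes I :: "'n::finite set set"
  assumes matroid: "matroid UNIV I"
begin

interpretation matroid UNIV I by (rule matroid)

abbreviation rank_fun :: "'n set \<Rightarrow> real" where
  "rank_fun S \<equiv> real (rk S)"

abbreviation cocircuit_count :: "'n set \<Rightarrow> real" where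
  "cocircuit_count \<equiv> hit_count (cocircuits UNIV I)"

lemma cocircuit_nonempty: "{} \<notin> cocircuits UNIV I"
  using cocircuit_meets_base bases_nonempty by blast

lemma cocircuit_polytope_eq: "cocircuit_polytope I = base_polytope cocircuit_count"
  unfolding cocircuit_polytope_def
  by (rule sum_simplex_on_eq_base_polytope[OF cocircuit_nonempty])

text \<open>The greedy algorithm: the elements that raise the rank when added form a maximal independent subset
  of the listed elements.\<close>
lemma greedy_vec_rank:
  assumes "distinct xs"
  shows "\<exists>B \<in> I. B \<subseteq> set xs \<and> card B = rk (set xs) \<and> greedy_vec rank_fun xs = e_vec B"
  using assms
proof (induction xs)
  case Nil
  then show ?case using empty_indep rk_empty by (auto simp: e_vec_def)
next
  case (Cons i xs)
  then obtain B where B: "B \<in> I" "B \<subseteq> set xs" "card B = rk (set xs)" "greedy_vec rank_fun xs = e_vec B"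
    by auto
  have i: "i \<notin> set xs" using Cons.prems by simp
  note rk = rk_insert[OF B(1-3) i]
  show ?case
  proof (cases "insert i B \<in> I")
    case True
    have "i \<notin> B" using B i by auto
    then have "axis i 1 + e_vec B = e_vec (insert i B)" by (simp add: e_vec_def)
    then show ?thesis
      using True B rk \<open>i \<notin> B\<close> by (intro bexI[OF _ True]) auto
  next
    case False
    then show ?thesis using B rk by (intro bexI[OF _ B(1)]) auto
  qed
qed

lemma greedy_vec_rank_in_matroid_polytope:
  assumes "xs \<in> permutations_of_set UNIV"
  shows "greedy_vec rank_fun xs \<in> matroid_polytope I"
proof -
  obtain B where "B \<in> I" "card B = rk UNIV" "greedy_vec rank_fun xs = e_vec B"
    using greedy_vec_rank[of xs] permutations_of_setD[OF assms] by auto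
  then show ?thesis unfolding matroid_polytope_def by (intro hull_inc) (simp add: bases_iff)
qed

lemma matroid_polytope_subset: "matroid_polytope I \<subseteq> base_polytope rank_fun"
  unfolding matroid_polytope_def
proof (intro hull_minimal convex_base_polytope image_subsetI)
  fix B assume B: "B \<in> bases I"
  have sum: "(\<Sum>i\<in>S. e_vec B $ i) = real (card (B \<inter> S))" for S
    by (simp add: e_vec_nth sum.If_cases Int_commute)
  have "card (B \<inter> S) \<le> rk S" for S
    using base_indep[OF B] by (intro card_le_rk) (auto intro: indep_mono)
  moreover have "card B = rk UNIV" using B by (simp add: bases_iff)
  ultimately show "e_vec B \<in> base_polytope rank_fun" by (simp add: base_polytope_def sum)
qed

text \<open>Summing \<open>hits_marginal\<close> over the cocircuits bounds the gain in the marginal of the cocircuit count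
  below by the number of cocircuits that contain \<open>i\<close>, avoid \<open>S\<close> and meet \<open>T\<close>. The marginal of the rank is
  zero or one, so its gain is at most one, and it is one only where \<open>separating_cocircuit\<close> supplies such
  a cocircuit.\<close>
lemma cocircuit_count_minus_rank_submodular:
  assumes "S \<subseteq> T" "i \<notin> T"
  shows "cocircuit_count (insert i T) - rank_fun (insert i T) + (cocircuit_count S - rank_fun S)
    \<le> cocircuit_count (insert i S) - rank_fun (insert i S) + (cocircuit_count T - rank_fun T)"
proof -
  let ?C = "cocircuits UNIV I"
  let ?sep = "\<lambda>D. if i \<in> D \<and> D \<inter> S = {} \<and> D \<inter> T \<noteq> {} then 1 else (0::real)"
  have "cocircuit_count (insert i T) + cocircuit_count S + sum ?sep ?C
      \<le> cocircuit_count (insert i S) + cocircuit_count T"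
    unfolding hit_count_def sum.distrib[symmetric]
    by (intro sum_mono hits_marginal assms)
  moreover have "rank_fun (insert i S) + rank_fun T - rank_fun (insert i T) - rank_fun S \<le> sum ?sep ?C"
  proof (cases "rk (insert i S) \<noteq> rk S \<and> rk (insert i T) = rk T")
    case True
    then obtain D where D: "D \<in> ?C" "i \<in> D" "D \<inter> S = {}" "D \<inter> T \<noteq> {}"
      using separating_cocircuit[OF assms] by blast
    have "?sep D \<le> sum ?sep ?C" using D by (intro member_le_sum) auto
    then show ?thesis using D True rk_insert_le[of i S] by simp
  next
    case False
    have "rk S \<le> rk (insert i S)" "rk T \<le> rk (insert i T)" by (auto intro: rk_mono)
    then have "rank_fun (insert i S) + rank_fun T - rank_fun (insert i T) - rank_fun S \<le> 0"
      using False rk_insert_le[of i S] by linarith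
    also have "0 \<le> sum ?sep ?C" by (intro sum_nonneg) simp
    finally show ?thesis .
  qed
  ultimately show ?thesis by linarith
qed

text \<open>The second summand \<open>Q\<close> is the base polytope of the cocircuit count minus the rank, given as the hull
  of its greedy vectors. One inclusion splits the greedy vectors of the count, the other adds up
  inequalities.\<close>
lemma matroid_polytope_summand:
  "minkowski_summand (matroid_polytope I) (cocircuit_polytope I)"
proof -
  let ?g = "\<lambda>S. cocircuit_count S - rank_fun S"
  let ?Q = "convex hull (greedy_vec ?g ` permutations_of_set UNIV)"
  have zero: "cocircuit_count {} = 0" by (simp add: hit_count_def hits_def)
  have count: "(\<lambda>S. rank_fun S + ?g S) = cocircuit_count" by simp
  have "base_polytope cocircuit_count
      \<subseteq> convex hull (greedy_vec cocircuit_count ` permutations_of_set UNIV)"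
    by (rule base_polytope_subset_hull) (rule zero)
  also have "\<dots> \<subseteq> matroid_polytope I + ?Q"
  proof (intro hull_minimal image_subsetI)
    show "convex (matroid_polytope I + ?Q)"
      by (intro convex_set_plus) (simp_all add: matroid_polytope_def)
    fix xs :: "'n list" assume xs: "xs \<in> permutations_of_set UNIV"
    have "greedy_vec cocircuit_count xs = greedy_vec rank_fun xs + greedy_vec ?g xs"
      using greedy_vec_add[of rank_fun ?g xs] unfolding count .
    moreover have "greedy_vec ?g xs \<in> ?Q" using xs by (intro hull_inc) auto
    ultimately show "greedy_vec cocircuit_count xs \<in> matroid_polytope I + ?Q"
      using greedy_vec_rank_in_matroid_polytope[OF xs] by (simp only: set_plus_intro)
  qed
  finally have sub: "cocircuit_polytope I \<subseteq> matroid_polytope I + ?Q"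
    unfolding cocircuit_polytope_eq .
  have "?Q \<subseteq> base_polytope ?g"
  proof (rule submodular_hull_subset_base_polytope)
    show "?g {} = 0" by (simp add: zero rk_empty)
  qed (rule cocircuit_count_minus_rank_submodular)
  then have "matroid_polytope I + ?Q \<subseteq> base_polytope rank_fun + base_polytope ?g"
    by (intro set_plus_mono2 matroid_polytope_subset)
  also have "\<dots> \<subseteq> base_polytope cocircuit_count"
    using base_polytope_plus_subset[of rank_fun ?g] unfolding count .
  finally have "cocircuit_polytope I = matroid_polytope I + ?Q"
    using sub unfolding cocircuit_polytope_eq by blast
  moreover have "polytope ?Q" by (simp add: polytope_convex_hull)
  moreover have "polytope (matroid_polytope I)"
    unfolding matroid_polytope_def by (simp add: polytope_convex_hull)
  ultimately show ?thesis unfolding minkowski_summand_def by blast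
qed

section \<open>Vertices and ordered bases\<close>

definition ordered_bases :: "'n list set" where
  "ordered_bases = (\<Union>B \<in> bases I. permutations_of_set B)"

lemma card_ordered_bases: "card ordered_bases \<le> fact (matroid_rank I) * card (bases I)"
proof -
  have "card ordered_bases \<le> (\<Sum>B\<in>bases I. card (permutations_of_set B))"
    unfolding ordered_bases_def by (rule card_UN_le) simp
  also have "\<dots> = (\<Sum>B\<in>bases I. fact (matroid_rank I))"
    by (rule sum.cong) (simp_all add: bases_iff matroid_rank_eq)
  finally show ?thesis by (simp add: mult.commute)
qed

lemma ex_max_weight_base:
  fixes w :: "'n \<Rightarrow> real"
  shows "\<exists>B \<in> bases I. \<forall>B' \<in> bases I. sum w B' \<le> sum w B"
proof -
  have "Max (sum w ` bases I) \<in> sum w ` bases I" using bases_nonempty by (intro Max_in) auto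
  then obtain B where "B \<in> bases I" "sum w B = Max (sum w ` bases I)" by auto
  then show ?thesis by (intro bexI[of _ B]) auto
qed

text \<open>For each functional \<open>w\<close> it suffices to order one basis, of maximum weight, by weight: every cocircuit
  meets it, and does so in an element that is heaviest in the whole cocircuit. The greedy vector
  therefore takes in each simplex a vertex that maximizes \<open>w\<close>.\<close>
lemma cocircuit_polytope_eq_hull_ordered_bases:
  "cocircuit_polytope I = convex hull (greedy_vec cocircuit_count ` ordered_bases)"
proof
  show "cocircuit_polytope I \<subseteq> convex hull (greedy_vec cocircuit_count ` ordered_bases)"
  proof
    fix x assume "x \<in> cocircuit_polytope I"
    then obtain s where s: "x = sum s (cocircuits UNIV I)"
        "\<And>D. D \<in> cocircuits UNIV I \<Longrightarrow> s D \<in> simplex_on D"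
      unfolding cocircuit_polytope_def using simplex_sum_memD by blast
    show "x \<in> convex hull (greedy_vec cocircuit_count ` ordered_bases)"
    proof (rule mem_convex_hull_if_dominated)
      show "finite (greedy_vec cocircuit_count ` ordered_bases)"
        unfolding ordered_bases_def by simp
      fix w :: "real ^ 'n"
      obtain B where B: "B \<in> bases I"
          "\<And>B'. B' \<in> bases I \<Longrightarrow> sum (($) w) B' \<le> sum (($) w) B"
        using ex_max_weight_base[of "($) w"] by blast
      obtain xs where xs: "distinct xs" "set xs = B" "sorted_wrt (\<lambda>i j. w $ i \<le> w $ j) xs"
        using ex_sorted_enumeration[of B "($) w"] by auto
      have "w \<bullet> s D \<le> w \<bullet> greedy_vec (hits D) xs" if D: "D \<in> cocircuits UNIV I" for D
      proof -
        have "D \<inter> set xs \<noteq> {}" using cocircuit_meets_base[OF D B(1)] xs by auto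
        then obtain m where m: "greedy_vec (hits D) xs = axis m 1"
            "\<forall>e \<in> D \<inter> B. w $ e \<le> w $ m"
          using greedy_vec_hits[OF xs(3), of D] xs by blast
        have "simplex_on D \<subseteq> {y. w \<bullet> y \<le> w $ m}"
          unfolding simplex_on_def
        proof (intro hull_minimal convex_halfspace_le image_subsetI)
          fix d assume "d \<in> D"
          then obtain e where "e \<in> D \<inter> B" "w $ d \<le> w $ e"
            using cocircuit_meets_max_weight_base[OF B D] by blast
          then have "w $ d \<le> w $ m" using m(2) order_trans by blast
          then show "axis d 1 \<in> {y. w \<bullet> y \<le> w $ m}" by (simp add: inner_axis)
        qed
        then show ?thesis using s(2)[OF D] m by (auto simp: inner_axis)
      qed
      then have "w \<bullet> x \<le> w \<bullet> greedy_vec cocircuit_count xs"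
        unfolding s(1) greedy_vec_hit_count inner_sum_right by (rule sum_mono)
      moreover have "xs \<in> ordered_bases" using xs B by (auto simp: ordered_bases_def)
      ultimately show "\<exists>v \<in> greedy_vec cocircuit_count ` ordered_bases. w \<bullet> x \<le> w \<bullet> v" by blast
    qed
  qed
  show "convex hull (greedy_vec cocircuit_count ` ordered_bases) \<subseteq> cocircuit_polytope I"
    unfolding cocircuit_polytope_def
  proof (intro hull_minimal convex_sum_simplex_on image_subsetI)
    fix xs assume "xs \<in> ordered_bases"
    then have "set xs \<in> bases I" by (auto simp: ordered_bases_def dest: permutations_of_setD)
    then show "greedy_vec cocircuit_count xs \<in> (\<Sum>D\<in>cocircuits UNIV I. simplex_on D)"
      using cocircuit_meets_base by (intro greedy_vec_hit_count_in_sum) blast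
  qed
qed

lemma cocircuit_polytope_vertices:
  "finite {v. v extreme_point_of cocircuit_polytope I}"
  "card {v. v extreme_point_of cocircuit_polytope I} \<le> fact (matroid_rank I) * card (bases I)"
proof -
  let ?V = "greedy_vec cocircuit_count ` ordered_bases"
  have fin: "finite ordered_bases" by (simp add: ordered_bases_def)
  have sub: "{v. v extreme_point_of cocircuit_polytope I} \<subseteq> ?V"
    unfolding cocircuit_polytope_eq_hull_ordered_bases
    using extreme_point_of_convex_hull by blast
  then show "finite {v. v extreme_point_of cocircuit_polytope I}"
    using fin finite_subset by blast
  have "card {v. v extreme_point_of cocircuit_polytope I} \<le> card ?V"
    using sub fin by (intro card_mono) auto
  also have "\<dots> \<le> card ordered_bases" by (rule card_image_le[OF fin])
  also note card_ordered_bases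
  finally show "card {v. v extreme_point_of cocircuit_polytope I} \<le> fact (matroid_rank I) * card (bases I)" .
qed

end

section \<open>The affine dimension\<close>

text \<open>The indicator vectors of the classes form an orthogonal basis.\<close>
lemma dim_constant_on_classes:
  fixes R :: "('n::finite \<times> 'n) set"
  assumes R: "equiv UNIV R"
  shows "dim {y :: real ^ 'n. \<forall>(a, b) \<in> R. y $ a = y $ b} = card (UNIV // R)"
proof -
  let ?Q = "UNIV // R"
  let ?Y = "{y :: real ^ 'n. \<forall>(a, b) \<in> R. y $ a = y $ b}"
  have ne: "K \<noteq> {}" if "K \<in> ?Q" for K using in_quotient_imp_non_empty[OF R that] .
  have disj: "K = L \<or> K \<inter> L = {}" if "K \<in> ?Q" "L \<in> ?Q" for K L
    using quotient_disj[OF R that] .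
  have inj: "inj_on e_vec ?Q"
  proof (rule inj_onI)
    fix K L :: "'n set" assume "e_vec K = e_vec L"
    then have "\<And>j. (j \<in> K) = (j \<in> L)" by (auto simp: vec_eq_iff e_vec_nth split: if_splits)
    then show "K = L" by blast
  qed
  show ?thesis
  proof (rule dim_unique)
    show "e_vec ` ?Q \<subseteq> ?Y"
    proof (intro image_subsetI CollectI ballI, clarify)
      fix K a b assume K: "K \<in> ?Q" and ab: "(a, b) \<in> R"
      then have "a \<in> K \<longleftrightarrow> b \<in> K"
        using in_quotient_imp_closed[OF R K] R by (meson equivE symD)
      then show "e_vec K $ a = e_vec K $ b" by (simp add: e_vec_nth)
    qed
    show "?Y \<subseteq> span (e_vec ` ?Q)"
    proof
      fix y assume y: "y \<in> ?Y"
      \<comment> \<open>The coefficient of a class is the common value of \<open>y\<close> on it, read off at a representative.\<close>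
      define rep where "rep K = (SOME k. k \<in> K)" for K :: "'n set"
      have "y = (\<Sum>K\<in>?Q. (y $ rep K) *\<^sub>R e_vec K)"
      proof (simp only: vec_eq_iff, rule allI)
        fix j
        let ?K = "R `` {j}"
        have jK: "j \<in> ?K" using equiv_class_self[OF R] by simp
        have KQ: "?K \<in> ?Q" by (simp add: quotientI)
        have "rep ?K \<in> ?K" unfolding rep_def using jK by (rule someI)
        then have "y $ j = y $ rep ?K" using y by auto
        have mem: "j \<in> K \<longleftrightarrow> K = ?K" if "K \<in> ?Q" for K
          using disj[OF that KQ] jK by blast
        have "(\<Sum>K\<in>?Q. (y $ rep K) *\<^sub>R e_vec K) $ j = (\<Sum>K\<in>?Q. if K = ?K then y $ rep K else 0)"
          unfolding sum_component by (rule sum.cong) (simp_all add: e_vec_nth mem)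
        then show "y $ j = (\<Sum>K\<in>?Q. (y $ rep K) *\<^sub>R e_vec K) $ j"
          using \<open>y $ j = y $ rep ?K\<close> KQ by simp
      qed
      also have "\<dots> \<in> span (e_vec ` ?Q)"
        by (intro span_sum span_scale span_base) auto
      finally show "y \<in> span (e_vec ` ?Q)" .
    qed
    show "independent (e_vec ` ?Q :: (real ^ 'n) set)"
    proof (rule pairwise_orthogonal_independent)
      show "pairwise orthogonal (e_vec ` ?Q :: (real ^ 'n) set)"
      proof (clarsimp simp: pairwise_def)
        fix K L assume KL: "K \<in> ?Q" "L \<in> ?Q" "(e_vec K :: real ^ 'n) \<noteq> e_vec L"
        then have "K \<inter> L = {}" using disj by blast
        then have "(e_vec K :: real ^ 'n) $ i * e_vec L $ i = 0" for i
          by (auto simp: e_vec_nth)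
        then show "orthogonal (e_vec K :: real ^ 'n) (e_vec L)"
          unfolding orthogonal_def inner_vec_def by (intro sum.neutral) simp
      qed
      show "(0 :: real ^ 'n) \<notin> e_vec ` ?Q"
      proof
        assume "(0 :: real ^ 'n) \<in> e_vec ` ?Q"
        then obtain K where "K \<in> ?Q" and K: "(0 :: real ^ 'n) = e_vec K" by blast
        then obtain k where "k \<in> K" using ne by blast
        then have "(e_vec K :: real ^ 'n) $ k = 1" by (simp add: e_vec_nth)
        then show False by (simp add: K[symmetric])
      qed
    qed
    show "card (e_vec ` ?Q :: (real ^ 'n) set) = card ?Q" by (rule card_image[OF inj])
  qed
qed

text \<open>A vector is orthogonal to \<open>e\<^sub>a - e\<^sub>b\<close> exactly if its coordinates at \<open>a\<close> and \<open>b\<close> agree, so the orthogonal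
  complement of the span is the space of the preceding lemma.\<close>
lemma dim_span_differences_on_classes:
  fixes R :: "('n::finite \<times> 'n) set"
  assumes R: "equiv UNIV R"
  shows "dim (span {axis a 1 - axis b 1 :: real ^ 'n | a b. (a, b) \<in> R}) + card (UNIV // R) = CARD('n)"
proof -
  let ?V = "{axis a 1 - axis b 1 :: real ^ 'n | a b. (a, b) \<in> R}"
  have "(\<forall>x \<in> span ?V. orthogonal x y) \<longleftrightarrow> (\<forall>x \<in> ?V. orthogonal x y)" for y
  proof (intro iffI ballI)
    fix x assume "\<forall>x \<in> ?V. orthogonal x y" "x \<in> span ?V"
    then have "orthogonal y x" using orthogonal_to_span[of x ?V y] by (simp add: orthogonal_commute)
    then show "orthogonal x y" by (simp add: orthogonal_commute)
  qed (simp add: span_base)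
  then have "{y \<in> UNIV. \<forall>x \<in> span ?V. orthogonal x y} = {y. \<forall>x \<in> ?V. orthogonal x y}"
    by simp
  also have "\<dots> = {y. \<forall>(a, b) \<in> R. y $ a = y $ b}"
  proof (intro Collect_cong)
    fix y :: "real ^ 'n"
    have "orthogonal (axis a 1 - axis b 1) y \<longleftrightarrow> y $ a = y $ b" for a b
      by (simp add: orthogonal_def inner_diff_left inner_axis')
    then show "(\<forall>x \<in> ?V. orthogonal x y) \<longleftrightarrow> (\<forall>(a, b) \<in> R. y $ a = y $ b)" by blast
  qed
  finally have "dim {y \<in> UNIV. \<forall>x \<in> span ?V. orthogonal x y} = card (UNIV // R)"
    using dim_constant_on_classes[OF R] by simp
  moreover have "dim {y \<in> UNIV. \<forall>x \<in> span ?V. orthogonal x y} + dim (span ?V) = dim (UNIV :: (real ^ 'n) set)"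
    by (rule dim_subspace_orthogonal_to_vectors) auto
  ultimately show ?thesis by (simp add: dim_UNIV)
qed

text \<open>Fix a point \<open>p\<close> that picks one vertex \<open>t D\<close> of each simplex. Moving the choice within one simplex
  changes \<open>p\<close> by a difference of unit vectors, and all points of the sum arise from \<open>p\<close> by combining
  such changes.\<close>
lemma aff_dim_sum_simplex_on:
  fixes F :: "'n::finite set set"
  assumes ne: "{} \<notin> F"
  shows "aff_dim (\<Sum>D\<in>F. simplex_on D) =
    int (dim (span {axis a 1 - axis b 1 :: real ^ 'n | a b. \<exists>D \<in> F. a \<in> D \<and> b \<in> D}))"
proof -
  let ?O = "\<Sum>D\<in>F. simplex_on D"
  let ?V = "{axis a 1 - axis b 1 :: real ^ 'n | a b. \<exists>D \<in> F. a \<in> D \<and> b \<in> D}"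
  define t where "t D = (axis (SOME d. d \<in> D) 1 :: real ^ 'n)" for D :: "'n set"
  have some: "(SOME d. d \<in> D) \<in> D" if "D \<in> F" for D
    using ne that by (metis some_in_eq)
  have t: "t D \<in> simplex_on D" if "D \<in> F" for D
    unfolding t_def by (rule axis_in_simplex[OF some[OF that]])
  define p where "p = sum t F"
  have p: "p \<in> ?O" unfolding p_def by (rule simplex_sum_memI[OF t])
  have "span ((\<lambda>x. - p + x) ` ?O) = span ?V"
  proof (rule subset_antisym; rule span_minimal)
    show "(\<lambda>x. - p + x) ` ?O \<subseteq> span ?V"
    proof (rule image_subsetI)
      fix x assume "x \<in> ?O"
      then obtain s where s: "x = sum s F" "\<And>D. D \<in> F \<Longrightarrow> s D \<in> simplex_on D"
        using simplex_sum_memD by blast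
      have "s D - t D \<in> span ?V" if D: "D \<in> F" for D
      proof -
        have "simplex_on D \<subseteq> {y. y - t D \<in> span ?V}"
          unfolding simplex_on_def
        proof (intro hull_minimal image_subsetI)
          fix d assume "d \<in> D"
          then have "axis d 1 - t D \<in> ?V" unfolding t_def using some[OF D] D by blast
          then show "axis d 1 \<in> {y. y - t D \<in> span ?V}" by (simp add: span_base)
        next
          show "convex {y. y - t D \<in> span ?V}"
          proof (rule convexI)
            fix y z :: "real ^ 'n" and u v :: real
            assume yz: "y \<in> {y. y - t D \<in> span ?V}" "z \<in> {y. y - t D \<in> span ?V}"
              and uv: "u + v = 1"
            have tD: "u *\<^sub>R t D + v *\<^sub>R t D = t D" using uv by (simp add: scaleR_add_left[symmetric])
            have "u *\<^sub>R (y - t D) + v *\<^sub>R (z - t D)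
                = u *\<^sub>R y + v *\<^sub>R z - (u *\<^sub>R t D + v *\<^sub>R t D)"
              by (simp add: scaleR_diff_right)
            then have "u *\<^sub>R y + v *\<^sub>R z - t D = u *\<^sub>R (y - t D) + v *\<^sub>R (z - t D)"
              unfolding tD by simp
            moreover have "u *\<^sub>R (y - t D) + v *\<^sub>R (z - t D) \<in> span ?V"
              using yz by (intro span_add span_scale) auto
            ultimately show "u *\<^sub>R y + v *\<^sub>R z \<in> {y. y - t D \<in> span ?V}" by simp
          qed
        qed
        then show ?thesis using s(2)[OF D] by blast
      qed
      then have "(\<Sum>D\<in>F. s D - t D) \<in> span ?V" by (rule span_sum)
      then show "- p + x \<in> span ?V" by (simp add: s(1) p_def sum_subtractf)
    qed
    show "?V \<subseteq> span ((\<lambda>x. - p + x) ` ?O)"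
    proof
      fix v assume "v \<in> ?V"
      then obtain a b D where v: "v = axis a 1 - axis b 1" and D: "D \<in> F" "a \<in> D" "b \<in> D"
        by blast
      have diff: "axis c 1 - t D \<in> (\<lambda>x. - p + x) ` ?O" if c: "c \<in> D" for c
      proof (rule image_eqI)
        let ?s = "t(D := axis c 1)"
        have "sum ?s F = axis c 1 + sum t (F - {D})"
          using D by (subst sum.remove[of F D]) (auto intro!: sum.cong)
        moreover have "p = t D + sum t (F - {D})"
          unfolding p_def using D by (subst sum.remove[of F D]) auto
        ultimately show "axis c 1 - t D = - p + sum ?s F" by simp
        show "sum ?s F \<in> ?O"
          using t axis_in_simplex[OF c] by (intro simplex_sum_memI) auto
      qed
      have "v = (axis a 1 - t D) - (axis b 1 - t D)" by (simp add: v)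
      also have "\<dots> \<in> span ((\<lambda>x. - p + x) ` ?O)"
        using D by (intro span_diff span_base diff)
      finally show "v \<in> span ((\<lambda>x. - p + x) ` ?O)" .
    qed
  qed (rule subspace_span)+
  then have "dim ((\<lambda>x. - p + x) ` ?O) = dim (span ?V)" using dim_span by metis
  then show ?thesis using aff_dim_eq_dim[OF hull_inc[OF p]] by simp
qed

lemma cocircuit_polytope_aff_dim:
  fixes I :: "'n::finite set set"
  assumes "matroid UNIV I"
  shows "aff_dim (cocircuit_polytope I) = int CARD('n) - int (card (matroid_components UNIV I))"
proof -
  interpret matroid UNIV I by fact
  let ?conn = "matroid_conn UNIV I"
  let ?V = "{axis a 1 - axis b 1 :: real ^ 'n | a b. \<exists>D \<in> cocircuits UNIV I. a \<in> D \<and> b \<in> D}"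
  let ?W = "{axis a 1 - axis b 1 :: real ^ 'n | a b. (a, b) \<in> ?conn}"
  have conn: "(a, b) \<in> ?conn \<longleftrightarrow> a = b \<or> (\<exists>D \<in> cocircuits UNIV I. a \<in> D \<and> b \<in> D)" for a b
    using common_circuit_iff_common_cocircuit[of a b] by (cases "a = b") (simp_all add: matroid_conn_def)
  have VW: "span ?V = span ?W"
  proof (rule subset_antisym; rule span_minimal)
    show "?V \<subseteq> span ?W"
    proof
      fix v assume "v \<in> ?V"
      then obtain a b where v: "v = axis a 1 - axis b 1"
        and "\<exists>D \<in> cocircuits UNIV I. a \<in> D \<and> b \<in> D" by blast
      then have "(a, b) \<in> ?conn" by (simp add: conn)
      then have "v \<in> ?W" using v by blast
      then show "v \<in> span ?W" by (rule span_base)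
    qed
    show "?W \<subseteq> span ?V"
    proof
      fix v assume "v \<in> ?W"
      then obtain a b where v: "v = axis a 1 - axis b 1" and ab: "(a, b) \<in> ?conn" by blast
      show "v \<in> span ?V"
      proof (cases "a = b")
        case True
        then show ?thesis by (simp add: v span_zero)
      next
        case False
        then have "\<exists>D \<in> cocircuits UNIV I. a \<in> D \<and> b \<in> D" using ab by (simp add: conn)
        then have "v \<in> ?V" using v by blast
        then show ?thesis by (rule span_base)
      qed
    qed
  qed (rule subspace_span)+
  have "aff_dim (cocircuit_polytope I) = int (dim (span ?W))"
    unfolding cocircuit_polytope_def VW[symmetric]
    by (rule aff_dim_sum_simplex_on[OF cocircuit_nonempty[OF assms]])
  moreover have "dim (span ?W) + card (matroid_components UNIV I) = CARD('n)"
    unfolding matroid_components_def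
    by (rule dim_span_differences_on_classes[OF equiv_matroid_conn])
  ultimately show ?thesis by linarith
qed

theorem theorem1p8:
  fixes I :: "'n::finite set set" and r :: nat
  assumes "matroid UNIV I"
    and "matroid_rank I = r"
  shows
    "(cocircuit_polytope I =
       {x :: real ^ 'n.
          (\<Sum>i\<in>UNIV. x $ i) = real (num_cocircuits_meeting UNIV I UNIV) \<and>
          (\<forall>S. (\<Sum>i\<in>S. x $ i) \<le> real (num_cocircuits_meeting UNIV I S))}) \<and>
     aff_dim (cocircuit_polytope I) =
       int CARD('n) - int (card (matroid_components UNIV I)) \<and>
     minkowski_summand (matroid_polytope I) (cocircuit_polytope I) \<and>
     finite {v. v extreme_point_of cocircuit_polytope I} \<and>
       card {v. v extreme_point_of cocircuit_polytope I} \<le> fact r * card (bases I)"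
proof (intro conjI)
  have "hit_count (cocircuits UNIV I) S = real (num_cocircuits_meeting UNIV I S)" for S
    unfolding num_cocircuits_meeting_def by (rule hit_count_eq_card) simp
  then show "cocircuit_polytope I =
       {x :: real ^ 'n.
          (\<Sum>i\<in>UNIV. x $ i) = real (num_cocircuits_meeting UNIV I UNIV) \<and>
          (\<forall>S. (\<Sum>i\<in>S. x $ i) \<le> real (num_cocircuits_meeting UNIV I S))}"
    unfolding cocircuit_polytope_eq[OF assms(1)] base_polytope_def by (simp only:)
qed (use cocircuit_polytope_aff_dim[OF assms(1)] matroid_polytope_summand[OF assms(1)]
      cocircuit_polytope_vertices[OF assms(1)] assms(2) in simp_all)

end
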